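(* Let $N\ge 1$, let $x\in\mathbb{R}$ be the initial price and let $\bar y=(y_1,\dots,y_N)\in[0,\theta]^N$ with $\sum_{i=1}^N y_i\le\theta$ be the vector of initial installed powers. Let $\mathcal{I}_N$ be the set of admissible joint installation strategies and let $\mathcal{J}_i(x,\bar y,\bar I)$ be the payoff of player $i$. Define the social planner functional $\mathcal{J}_{SP}(\bar I)=\sum_{i=1}^N \mathcal{J}_i(x,\bar y,\bar I)$ for $\bar I\in\mathcal{I}_N$. If $\hat I\in\arg\max_{\bar I\in\mathcal{I}_N}\mathcal{J}_{SP}(\bar I)$, then $\hat I$ is Pareto optimal, i.e. there is no $I^*\in\mathcal{I}_N$ such that $\mathcal{J}_i(x,\bar y,I^* )\ge\mathcal{J}_i(x,\bar y,\hat I)$ for all $i\in\{1,\dots,N\}$ with strict inequality for at least one $i$.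
   Context: Constants: $\kappa,\sigma,\rho,a,c,\theta>0$, $\beta\ge 0$, $\zeta\in\mathbb{R}$. $(\Omega,\mathcal{F},(\mathcal{F}_t)_{t\ge0},\mathbb{P})$ is a complete filtered probability space carrying a one-dimensional Brownian motion $W$, where $(\mathcal{F}_t)$ is the natural filtration of $W$ augmented by the $\mathbb{P}$-null sets. The set $\mathcal{I}_N$ of admissible strategies (given $\bar y$) consists of all processes $\bar I=(I_1,\dots,I_N):[0,\infty)\times\Omega\to[0,\infty)^N$ that are adapted, with each $I_i$ nondecreasing, càdlàg, $I_i(0-)=0$, and such that $\sum_{i=1}^N (y_i+I_i(s))\le\theta$ $\mathbb{P}$-a.s. for all $s\ge0$. For $\bar I\in\mathcal{I}_N$ the electricity price $S^{x,\bar y,\bar I}$ solves $$dS^{x,\bar y,\bar I}(s)=\kappa\Big(\zeta-\beta\sum_{i=1}^N (y_i+I_i(s))-S^{x,\bar y,\bar I}(s)\Big)ds+\sigma\,dW(s),\quad s>0,\qquad S^{x,\bar y,\bar I}(0)=x.$$ The payoff of player $i$ is $$\mathcal{J}_i(x,\bar y,\bar I)=\mathbb{E}\left[\int_0^\infty e^{-\rho\tau}S^{x,\bar y,\bar I}(\tau)\,a\,(y_i+I_i(\tau))\,d\tau-c\int_0^\infty e^{-\rho\tau}\,dI_i(\tau)\right],$$ where the integral with respect to $dI_i$ includes a possible jump at time $0$ of size $I_i(0)-I_i(0-)$. *)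

theory Defs
  imports "HOL-Probability.Probability"
begin

definition brownian_motion :: "'w measure \<Rightarrow> (real \<Rightarrow> 'w \<Rightarrow> real) \<Rightarrow> bool" where
  "brownian_motion M W \<longleftrightarrow>
     (\<forall>t\<ge>0. W t \<in> borel_measurable M) \<and>
     (AE \<omega> in M. W 0 \<omega> = 0) \<and>
     (AE \<omega> in M. continuous_on {0..} (\<lambda>t. W t \<omega>)) \<and>
     (\<forall>s t. 0 \<le> s \<and> s < t \<longrightarrow>
        distributed M lborel (\<lambda>\<omega>. W t \<omega> - W s \<omega>) (normal_density 0 (sqrt (t - s)))) \<and>
     (\<forall>n (t :: nat \<Rightarrow> real). 0 \<le> t 0 \<and> (\<forall>k<n. t k < t (Suc k)) \<longrightarrow>
        prob_space.indep_vars M (\<lambda>_. borel) (\<lambda>k \<omega>. W (t (Suc k)) \<omega> - W (t k) \<omega>) {..<n})"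

text \<open>On a complete space every subset of a null set is itself in \<^term>\<open>null_sets M\<close>, so this
  is the usual augmentation. Times are real numbers; only \<open>t \<ge> 0\<close> is ever used.\<close>

definition augmented_filtration ::
    "'w measure \<Rightarrow> (real \<Rightarrow> 'w \<Rightarrow> real) \<Rightarrow> real \<Rightarrow> 'w measure" where
  "augmented_filtration M W t =
     sigma (space M)
       ({W s -` B \<inter> space M | s B. 0 \<le> s \<and> s \<le> t \<and> B \<in> sets borel} \<union> null_sets M)"

lemma filtration_augmented_filtration: "filtration (space M) (augmented_filtration M W)"
proof
  have sub: "{W s -` B \<inter> space M | s B. 0 \<le> s \<and> s \<le> t \<and> B \<in> sets borel} \<union> null_sets M
      \<subseteq> Pow (space M)" for t
    using sets.sets_into_space by fastforce
  show "space (augmented_filtration M W t) = space M" for t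
    unfolding augmented_filtration_def by (intro space_measure_of sub)
  show "sets (augmented_filtration M W s) \<subseteq> sets (augmented_filtration M W t)" if "s \<le> t" for s t
    unfolding augmented_filtration_def sets_measure_of[OF sub]
    using that by (intro sigma_sets_mono') fastforce
qed

definition adapted :: "(real \<Rightarrow> 'w measure) \<Rightarrow> (real \<Rightarrow> 'w \<Rightarrow> real) \<Rightarrow> bool" where
  "adapted F X \<longleftrightarrow> (\<forall>t\<ge>0. X t \<in> borel_measurable (F t))"

definition cadlag :: "(real \<Rightarrow> real) \<Rightarrow> bool" where
  "cadlag f \<longleftrightarrow> (\<forall>t. continuous (at_right t) f \<and> (\<exists>l. (f \<longlongrightarrow> l) (at_left t)))"

text \<open>A joint strategy is \<open>I i t \<omega>\<close>, with players \<open>i \<in> {1..N}\<close>; values at other indices are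
  irrelevant. The convention \<open>I\<^sub>i(0-) = 0\<close> is encoded by extending each path by \<open>0\<close> to negative
  times, so that a strictly positive \<open>I\<^sub>i(0)\<close> is a jump at time \<open>0\<close>.\<close>

type_synonym 'w strategy = "nat \<Rightarrow> real \<Rightarrow> 'w \<Rightarrow> real"

definition admissible ::
    "'w measure \<Rightarrow> (real \<Rightarrow> 'w \<Rightarrow> real) \<Rightarrow> nat \<Rightarrow> real \<Rightarrow> (nat \<Rightarrow> real) \<Rightarrow> 'w strategy set" where
  "admissible M W N \<theta> y =
     {I. (\<forall>i\<in>{1..N}.
            adapted (augmented_filtration M W) (I i) \<and>
            (\<forall>\<omega>\<in>space M.
               (\<forall>t<0. I i t \<omega> = 0) \<and> (\<forall>t\<ge>0. 0 \<le> I i t \<omega>) \<and>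
               mono (\<lambda>t. I i t \<omega>) \<and> cadlag (\<lambda>t. I i t \<omega>))) \<and>
         (AE \<omega> in M. \<forall>s\<ge>0. (\<Sum>i=1..N. y i + I i s \<omega>) \<le> \<theta>)}"

text \<open>Strong solution, in integrated form, of
  \<open>dS(s) = \<kappa> (\<zeta> - \<beta> (\<Sum>i. y\<^sub>i + I\<^sub>i(s)) - S(s)) ds + \<sigma> dW(s)\<close>, \<open>S(0) = x\<close>.
  For admissible \<open>I\<close> the drift is bounded on compact time intervals almost surely (\<open>S\<close> is
  continuous and \<open>I\<close> is monotone), so its Lebesgue integral exists.\<close>

definition price_solution ::
    "'w measure \<Rightarrow> (real \<Rightarrow> 'w \<Rightarrow> real) \<Rightarrow> real \<Rightarrow> real \<Rightarrow> real \<Rightarrow> real \<Rightarrow>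
     nat \<Rightarrow> real \<Rightarrow> (nat \<Rightarrow> real) \<Rightarrow> 'w strategy \<Rightarrow> (real \<Rightarrow> 'w \<Rightarrow> real) \<Rightarrow> bool" where
  "price_solution M W \<kappa> \<zeta> \<beta> \<sigma> N x y I S \<longleftrightarrow>
     adapted (augmented_filtration M W) S \<and>
     (AE \<omega> in M. continuous_on {0..} (\<lambda>t. S t \<omega>)) \<and>
     (AE \<omega> in M. \<forall>t\<ge>0.
        S t \<omega> = x + (LINT s:{0..t}|lborel. \<kappa> * (\<zeta> - \<beta> * (\<Sum>i=1..N. y i + I i s \<omega>) - S s \<omega>))
                  + \<sigma> * W t \<omega>)"

text \<open>The price process enters as a family \<open>S\<close> indexed by the joint strategy. The
  Lebesgue-Stieltjes integral is taken over the closed half-line, hence includes the jump at \<open>0\<close>.\<close>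

definition payoff ::
    "'w measure \<Rightarrow> real \<Rightarrow> real \<Rightarrow> real \<Rightarrow> (nat \<Rightarrow> real) \<Rightarrow>
     ('w strategy \<Rightarrow> real \<Rightarrow> 'w \<Rightarrow> real) \<Rightarrow> nat \<Rightarrow> 'w strategy \<Rightarrow> real" where
  "payoff M \<rho> a c y S i I =
     (LINT \<omega>|M.
        (LINT \<tau>:{0..}|lborel. exp (- \<rho> * \<tau>) * S I \<tau> \<omega> * a * (y i + I i \<tau> \<omega>))
        - c * (LINT \<tau>:{0..}|interval_measure (\<lambda>t. I i t \<omega>). exp (- \<rho> * \<tau>)))"

definition social_planner ::
    "'w measure \<Rightarrow> real \<Rightarrow> real \<Rightarrow> real \<Rightarrow> (nat \<Rightarrow> real) \<Rightarrow>
     ('w strategy \<Rightarrow> real \<Rightarrow> 'w \<Rightarrow> real) \<Rightarrow> nat \<Rightarrow> 'w strategy \<Rightarrow> real" where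
  "social_planner M \<rho> a c y S N I = (\<Sum>i=1..N. payoff M \<rho> a c y S i I)"

definition pareto_optimal :: "nat \<Rightarrow> (nat \<Rightarrow> 's \<Rightarrow> real) \<Rightarrow> 's set \<Rightarrow> 's \<Rightarrow> bool" where
  "pareto_optimal N J A I \<longleftrightarrow>
     I \<in> A \<and>
     \<not> (\<exists>I'\<in>A. (\<forall>i\<in>{1..N}. J i I' \<ge> J i I) \<and> (\<exists>i\<in>{1..N}. J i I' > J i I))"

end

theory Submission
  imports Defs
begin

text \<open>A Pareto improvement lowers no player's payoff and raises at least one, so it strictly
  raises the sum of the finitely many real payoffs. A maximizer of the sum therefore admits none.
  \<open>pareto_optimal_if_arg_max_sum\<close> says this for an abstract payoff family
  \<open>J\<close> on a set \<open>A\<close>; the theorem is its instance at the energy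
  game.\<close>

lemma pareto_optimal_if_arg_max_sum:
  assumes "is_arg_max (\<lambda>I. \<Sum>i=1..N. J i I) (\<lambda>I. I \<in> A) I"
  shows "pareto_optimal N J A I"
  unfolding pareto_optimal_def
proof (intro conjI notI)
  show "I \<in> A"
    using assms by (simp add: is_arg_max_def)
next
  assume "\<exists>I'\<in>A. (\<forall>i\<in>{1..N}. J i I' \<ge> J i I) \<and> (\<exists>i\<in>{1..N}. J i I' > J i I)"
  then obtain I' where "I' \<in> A"
    and "\<forall>i\<in>{1..N}. J i I \<le> J i I'" "\<exists>i\<in>{1..N}. J i I < J i I'"
    by blast
  moreover from this have "(\<Sum>i=1..N. J i I) < (\<Sum>i=1..N. J i I')"
    \<comment> \<open>One strict term makes the whole sum strict because \<open>{1..N}\<close> is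
      finite and all other terms are weakly ordered.\<close>
    by (intro sum_strict_mono_ex1) auto
  ultimately show False
    \<comment> \<open>\<open>is_arg_max\<close> says precisely that no element of \<open>A\<close>
      has a strictly larger sum.\<close>
    using assms by (auto simp: is_arg_max_def)
qed

theorem lemma5p1:
  fixes M :: "'w measure" and W :: "real \<Rightarrow> 'w \<Rightarrow> real"
    and S :: "'w strategy \<Rightarrow> real \<Rightarrow> 'w \<Rightarrow> real"
    and I_hat :: "'w strategy"
    and N :: nat and y :: "nat \<Rightarrow> real"
    and x \<kappa> \<sigma> \<rho> a c \<theta> \<beta> \<zeta> :: real
  assumes "prob_space M" and "complete_measure M"
    and "brownian_motion M W"
    and "\<kappa> > 0" "\<sigma> > 0" "\<rho> > 0" "a > 0" "c > 0" "\<theta> > 0" "\<beta> \<ge> 0"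
    and "N \<ge> 1"
    and "\<forall>i\<in>{1..N}. y i \<in> {0..\<theta>}" and "(\<Sum>i=1..N. y i) \<le> \<theta>"
    and "\<forall>I\<in>admissible M W N \<theta> y. price_solution M W \<kappa> \<zeta> \<beta> \<sigma> N x y I (S I)"
    and "is_arg_max (social_planner M \<rho> a c y S N) (\<lambda>I. I \<in> admissible M W N \<theta> y) I_hat"
  shows "pareto_optimal N (payoff M \<rho> a c y S) (admissible M W N \<theta> y) I_hat"
  \<comment> \<open>Once unfolded, the maximality hypothesis has the sum form of the lemma's
    premise, with \<open>J\<close> the map sending \<open>i\<close> to the payoff of player
    \<open>i\<close>.\<close>
  using assms(15) unfolding social_planner_def by (rule pareto_optimal_if_arg_max_sum)

end
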